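(* Let $G$ be a locally finite infinite connected graph whose edge weights $(w_e)_{e\in E(G)}$ are i.i.d. nonnegative random variables with a continuous distribution $F$. Suppose that $G$ satisfies the correlation decay assumption: for each $e\in E(G)$, $\varrho_r(G,e)\to 0$ as $r\to\infty$. Fix $e\in E(G)$ and let $(G_n)$ be a sequence of finite graphs that increases to $G$. Then the following statements hold almost surely. (a) $\lim_{n\to\infty}\mathbf{1}_{\{e\in \mathsf{M}_{G_n}\}}$ exists. Let $\mathsf{M}_G\subseteq E(G)$ be the set of all edges $e\in E(G)$ such that $\lim_{n\to\infty}\mathbf{1}_{\{e\in\mathsf{M}_{G_n}\}}=1$. (b) $\mathsf{M}_G$ does not depend on the choice of $(G_n)$; more precisely, if $(G_n')$ is another sequence of finite graphs that increases to $G$, then $$\lim_{n\to\infty}\mathbf{1}_{\{e\in\mathsf{M}_{G_n'}\}}=\lim_{n\to\infty}\mathbf{1}_{\{e\in\mathsf{M}_{G_n}\}}.$$ (c) $\mathsf{M}_G$ is a matching. (d) (Local optimality) For any matching $M$ of $G$ such that $|M\triangle \mathsf{M}_G|<\infty$ and $M\ne\mathsf{M}_G$, we have $$\sum_{e\in\mathsf{M}_G\setminus M}w_e>\sum_{e\in M\setminus\mathsf{M}_G}w_e.$$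
   Context: A graph $G=(V(G),E(G))$ is undirected, with edges $(uv)$ being unordered pairs of distinct vertices. For $u,v\in V(G)$, $u\sim_G v$ means $(uv)\in E(G)$. A sequence of finite graphs $(G_n)$ increases to $G$ if each $G_n$ is a subgraph of $G$ and of $G_{n+1}$, and $\bigcup_n G_n=G$ (vertices and edges). A matching of a graph is a set of edges no two of which share a vertex. For a finite graph $H$ with edge weights $(w_e)$, the weight of a matching $M$ is $w_M=\sum_{e\in M}w_e$, and $\mathsf{M}_H$ denotes the maximum weight matching (the matching of $H$ maximizing $w_M$), which is almost surely unique for i.i.d. weights from a continuous distribution (i.e. one without atoms). Subgraphs of $G$ inherit the edge weights of $G$. For an edge $e=(uv)$ of $G$ and $r\ge 0$, $\mathbb{B}_e^r(G)$ is the subgraph of $G$ induced by all vertices whose graph distance (in $G$) from $u$ or from $v$ is at most $r$. For a subgraph $H$ of $G$, its boundary is $\partial H=\{v\in V(H): v\sim_G u \text{ for some } u\in V(G)\setminus V(H)\}$. For $A\subseteq V(H)$, $H\setminus A$ is the induced subgraph of $H$ on $V(H)\setminus A$. For a locally finite connected graph $G$, $e\in E(G)$ and $r\ge1$, define $$\varrho_r(G,e)=\mathbf{E}\sup_{A\subseteq \partial \mathbb{B}_e^r(G)}\bigl|\mathbf{1}_{\{e\in \mathsf{M}_{\mathbb{B}_e^r(G)}\}}-\mathbf{1}_{\{e\in \mathsf{M}_{\mathbb{B}_e^r(G)\setminus A}\}}\bigr|,$$ where the expectation is over the edge weights. *)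

theory Defs
  imports "HOL-Probability.Probability"
begin

record 'v ugraph =
  verts :: "'v set"
  edges :: "'v set set"

definition ugraph :: "'v ugraph \<Rightarrow> bool" where
  "ugraph G \<longleftrightarrow> (\<forall>e\<in>edges G. e \<subseteq> verts G \<and> card e = 2)"

definition adjacent :: "'v ugraph \<Rightarrow> 'v \<Rightarrow> 'v \<Rightarrow> bool" where
  "adjacent G u v \<longleftrightarrow> {u, v} \<in> edges G"

definition walks :: "'v ugraph \<Rightarrow> 'v \<Rightarrow> 'v \<Rightarrow> 'v list set" where
  "walks G u v = {p. p \<noteq> [] \<and> set p \<subseteq> verts G \<and> hd p = u \<and> last p = v \<and> successively (adjacent G) p}"

text \<open>The distance is the least number of edges of a walk, and \<open>\<infinity>\<close> if there is no walk.\<close>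

definition graph_dist :: "'v ugraph \<Rightarrow> 'v \<Rightarrow> 'v \<Rightarrow> enat" where
  "graph_dist G u v = (INF p\<in>walks G u v. enat (length p - 1))"

definition connected_ugraph :: "'v ugraph \<Rightarrow> bool" where
  "connected_ugraph G \<longleftrightarrow> (\<forall>u\<in>verts G. \<forall>v\<in>verts G. walks G u v \<noteq> {})"

definition locally_finite :: "'v ugraph \<Rightarrow> bool" where
  "locally_finite G \<longleftrightarrow> (\<forall>v\<in>verts G. finite {u. adjacent G v u})"

text \<open>Subgraphs need not be induced.\<close>

definition subgraph :: "'v ugraph \<Rightarrow> 'v ugraph \<Rightarrow> bool" where
  "subgraph H G \<longleftrightarrow> ugraph H \<and> verts H \<subseteq> verts G \<and> edges H \<subseteq> edges G"

definition increases_to :: "(nat \<Rightarrow> 'v ugraph) \<Rightarrow> 'v ugraph \<Rightarrow> bool" where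
  "increases_to Gs G \<longleftrightarrow>
     (\<forall>n. finite (verts (Gs n)) \<and> subgraph (Gs n) G \<and> subgraph (Gs n) (Gs (Suc n))) \<and>
     (\<Union>n. verts (Gs n)) = verts G \<and> (\<Union>n. edges (Gs n)) = edges G"

definition induced :: "'v ugraph \<Rightarrow> 'v set \<Rightarrow> 'v ugraph" where
  "induced G S = \<lparr>verts = verts G \<inter> S, edges = {e \<in> edges G. e \<subseteq> S}\<rparr>"

definition delete_verts :: "'v ugraph \<Rightarrow> 'v set \<Rightarrow> 'v ugraph" where
  "delete_verts H A = induced H (verts H - A)"

definition edge_ball :: "'v ugraph \<Rightarrow> 'v set \<Rightarrow> nat \<Rightarrow> 'v ugraph" where
  "edge_ball G e r = induced G {v \<in> verts G. \<exists>u\<in>e. graph_dist G u v \<le> enat r}"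

definition vertex_boundary :: "'v ugraph \<Rightarrow> 'v ugraph \<Rightarrow> 'v set" where
  "vertex_boundary G H = {v \<in> verts H. \<exists>u \<in> verts G - verts H. adjacent G v u}"

definition matching :: "'v ugraph \<Rightarrow> 'v set set \<Rightarrow> bool" where
  "matching H M \<longleftrightarrow> M \<subseteq> edges H \<and> pairwise disjnt M"

text \<open>
  For a finite graph a maximiser always exists, and for i.i.d. weights without atoms it is
  almost surely unique. On the exceptional null event \<open>ARG_MAX\<close> selects some maximiser.
\<close>

definition max_matching :: "'v ugraph \<Rightarrow> ('v set \<Rightarrow> real) \<Rightarrow> 'v set set" where
  "max_matching H w = (ARG_MAX (\<lambda>M. \<Sum>e\<in>M. w e) M. matching H M)"

definition corr_rho ::
    "'a measure \<Rightarrow> ('v set \<Rightarrow> 'a \<Rightarrow> real) \<Rightarrow> nat \<Rightarrow> 'v ugraph \<Rightarrow> 'v set \<Rightarrow> real" where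
  "corr_rho P w r G e =
     (let B = edge_ball G e r in
      \<integral>\<omega>. (SUP A \<in> Pow (vertex_boundary G B).
            \<bar>indicat_real (max_matching B (\<lambda>f. w f \<omega>)) e
             - indicat_real (max_matching (delete_verts B A) (\<lambda>f. w f \<omega>)) e\<bar>) \<partial>P)"

definition limit_matching ::
    "'v ugraph \<Rightarrow> (nat \<Rightarrow> 'v ugraph) \<Rightarrow> ('v set \<Rightarrow> real) \<Rightarrow> 'v set set" where
  "limit_matching G Gs w =
     {f \<in> edges G. (\<lambda>n. indicat_real (max_matching (Gs n) w) f) \<longlonglongrightarrow> 1}"

end

theory Submission
  imports Defs
begin

text \<open>
  The part of a maximum weight matching of a finite graph \<open>K\<close> that lies in an induced ball \<open>B\<close> is the
  maximum weight matching of \<open>B\<close> with some boundary vertices \<open>A\<close> deleted, namely those matched by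
  \<open>K\<close> to the outside of \<open>B\<close>. The supremum in the definition of the correlation decay is \<open>{0, 1}\<close>-valued
  and its expectation tends to \<open>0\<close>, so almost surely it vanishes at some radius; at this radius,
  membership of \<open>f\<close> in the maximum matching is the same for every finite \<open>K\<close> containing the ball. This
  radius depends only on the weights, so the exceptional null set is common to all exhausting
  sequences. Local optimality follows by transferring a finite exchange to \<open>Gs n\<close> for large \<open>n\<close>,
  where it is strict because almost surely any two finite edge sets have different weights.
\<close>

text \<open>Comparing all finite edge sets of \<open>G\<close>, rather than the maximisers of chosen
  subgraphs, gives one event on which every finite subgraph of every exhausting sequence has a
  unique maximum weight matching.\<close>

definition distinct_weights :: "'v ugraph \<Rightarrow> ('v set \<Rightarrow> real) \<Rightarrow> bool" where
  "distinct_weights G W \<longleftrightarrow> inj_on (sum W) {M. finite M \<and> M \<subseteq> edges G}"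

text \<open>For fixed weights \<open>W\<close>, this says that the supremum inside the expectation
  \<open>corr_rho\<close> vanishes at radius \<open>r\<close>.\<close>

definition decays_at :: "'v ugraph \<Rightarrow> ('v set \<Rightarrow> real) \<Rightarrow> 'v set \<Rightarrow> nat \<Rightarrow> bool" where
  "decays_at G W f r \<longleftrightarrow>
     (\<forall>A\<subseteq>vertex_boundary G (edge_ball G f r).
        f \<in> max_matching (delete_verts (edge_ball G f r) A) W \<longleftrightarrow> f \<in> max_matching (edge_ball G f r) W)"

section \<open>Maximum weight matchings of finite graphs\<close>

lemma finite_edges_if_finite_verts:
  assumes "ugraph H" "finite (verts H)"
  shows "finite (edges H)"
  using assms by (auto simp: ugraph_def intro: finite_subset[of _ "Pow (verts H)"])

lemma finite_matchings: "finite (edges H) \<Longrightarrow> finite (Collect (matching H))"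
  by (rule finite_subset[of _ "Pow (edges H)"]) (auto simp: matching_def)

lemma matching_finite: "finite (edges H) \<Longrightarrow> matching H M \<Longrightarrow> finite M"
  by (auto simp: matching_def intro: finite_subset)

lemma max_matching_is_arg_max:
  assumes "finite (edges H)"
  shows "is_arg_max (\<lambda>M. \<Sum>e\<in>M. W e) (matching H) (max_matching H W)"
proof -
  let ?S = "Collect (matching H)" and ?w = "\<lambda>M. \<Sum>e\<in>M. W e"
  have fin: "finite (?w ` ?S)" using finite_matchings[OF assms] by simp
  have "{} \<in> ?S" by (simp add: matching_def)
  then have "?w ` ?S \<noteq> {}" by blast
  from Max_in[OF fin this] obtain M where M: "matching H M" "?w M = Max (?w ` ?S)" by auto
  have "is_arg_max ?w (matching H) M"
    using M Max_ge[OF fin] by (auto simp: is_arg_max_linorder)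
  then show ?thesis
    unfolding max_matching_def arg_max_def by (rule someI)
qed

lemma max_matching_matching: "finite (edges H) \<Longrightarrow> matching H (max_matching H W)"
  using max_matching_is_arg_max[of H W] by (simp add: is_arg_max_linorder)

lemma max_matching_ge: "finite (edges H) \<Longrightarrow> matching H M \<Longrightarrow> sum W M \<le> sum W (max_matching H W)"
  using max_matching_is_arg_max[of H W] by (simp add: is_arg_max_linorder)

text \<open>Maximality supplies the reverse inequality, so the two weights agree and injectivity
  identifies the matchings. The contrapositive is what makes an exchange strict.\<close>

lemma max_matching_eqI:
  assumes "distinct_weights G W" "finite (edges H)" "edges H \<subseteq> edges G" "matching H M"
    and "sum W (max_matching H W) \<le> sum W M"
  shows "M = max_matching H W"
proof -
  note mm = max_matching_matching[OF assms(2), of W]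
  have "sum W M = sum W (max_matching H W)"
    using assms(5) max_matching_ge[OF assms(2,4), of W] by simp
  moreover have "M \<in> {M. finite M \<and> M \<subseteq> edges G}" "max_matching H W \<in> {M. finite M \<and> M \<subseteq> edges G}"
    using matching_finite[OF assms(2)] assms(3,4) mm by (auto simp: matching_def)
  ultimately show ?thesis
    using assms(1) unfolding distinct_weights_def inj_on_def by blast
qed

text \<open>Ties make \<open>ARG_MAX\<close> an arbitrary choice, yet the choice depends on \<omega>
  only through the set \<open>S \<omega>\<close> of maximisers. That set takes finitely many values,
  and each level set is cut out by finitely many comparisons of measurable sums. Hence the integrand
  of \<open>corr_rho\<close> is measurable.\<close>

lemma measurable_max_matching:
  assumes "finite (edges H)" and [measurable]: "\<And>f. f \<in> edges H \<Longrightarrow> w f \<in> borel_measurable P"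
  shows "(\<lambda>\<omega>. max_matching H (\<lambda>f. w f \<omega>)) \<in> measurable P (count_space UNIV)"
proof -
  let ?C = "Collect (matching H)"
  define S where "S \<omega> = {M. is_arg_max (\<lambda>M. \<Sum>e\<in>M. w e \<omega>) (matching H) M}" for \<omega>
  have finC: "finite ?C" using finite_matchings assms(1) .
  have [measurable]: "(\<lambda>\<omega>. \<Sum>e\<in>M. w e \<omega>) \<in> borel_measurable P" if "M \<in> ?C" for M
    using that by (intro borel_measurable_sum assms(2)) (auto simp: matching_def)
  have "S \<in> measurable P (count_space (Pow ?C))"
    unfolding measurable_count_space_eq2[OF finite_Pow_iff[THEN iffD2, OF finC]]
  proof (intro conjI ballI)
    show "S \<in> space P \<rightarrow> Pow ?C" by (auto simp: S_def is_arg_max_def)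
    fix a assume "a \<in> Pow ?C"
    moreover have "S \<omega> \<subseteq> ?C" for \<omega> by (auto simp: S_def is_arg_max_def)
    ultimately have "S \<omega> = a \<longleftrightarrow> (\<forall>M\<in>?C. M \<in> a \<longleftrightarrow> M \<in> S \<omega>)" for \<omega> by blast
    also have "(\<forall>M\<in>?C. M \<in> a \<longleftrightarrow> M \<in> S \<omega>) \<longleftrightarrow>
        (\<forall>M\<in>?C. M \<in> a \<longleftrightarrow> (\<forall>M'\<in>?C. (\<Sum>e\<in>M'. w e \<omega>) \<le> (\<Sum>e\<in>M. w e \<omega>)))" for \<omega>
      by (rule ball_cong) (simp_all add: S_def is_arg_max_linorder)
    finally have iff: "S \<omega> = a \<longleftrightarrow>
        (\<forall>M\<in>?C. M \<in> a \<longleftrightarrow> (\<forall>M'\<in>?C. (\<Sum>e\<in>M'. w e \<omega>) \<le> (\<Sum>e\<in>M. w e \<omega>)))" for \<omega> .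
    have "S -` {a} \<inter> space P = {\<omega>\<in>space P. S \<omega> = a}" by auto
    also have "\<dots> \<in> sets P"
      unfolding iff using finC by measurable
    finally show "S -` {a} \<inter> space P \<in> sets P" .
  qed
  then have "(\<lambda>\<omega>. SOME M. M \<in> S \<omega>) \<in> measurable P (count_space UNIV)"
    by (rule measurable_compose) simp
  then show ?thesis
    by (simp add: S_def max_matching_def arg_max_def)
qed

section \<open>Almost sure distinctness of finite weight sums\<close>

text \<open>By independence and Fubini, the line \<open>x + y = c\<close> is integrated over its
  sections at fixed \<open>y\<close>. Each section is the single point \<open>c - y\<close>, which
  is null for the law of \<open>X\<close>.\<close>

lemma (in prob_space) AE_add_neq_if_atomless:
  fixes X Y :: "'a \<Rightarrow> real"
  assumes indep: "indep_var borel X borel Y"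
    and atomless: "\<And>x. emeasure (distr M borel X) {x} = 0"
  shows "AE \<omega> in M. X \<omega> + Y \<omega> \<noteq> c"
proof -
  have [measurable]: "random_variable borel X" "random_variable borel Y"
    and eq: "distr M borel X \<Otimes>\<^sub>M distr M borel Y = distr M (borel \<Otimes>\<^sub>M borel) (\<lambda>x. (X x, Y x))"
    using indep by (auto simp: indep_var_distribution_eq)
  interpret X: prob_space "distr M borel X" by (rule prob_space_distr) simp
  interpret Y: prob_space "distr M borel Y" by (rule prob_space_distr) simp
  interpret XY: pair_sigma_finite "distr M borel X" "distr M borel Y" ..
  let ?A = "{z :: real \<times> real. fst z + snd z = c}"
  have "{z \<in> space (borel \<Otimes>\<^sub>M borel). fst z + snd z = c} \<in> sets (borel \<Otimes>\<^sub>M borel)"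
    by measurable
  then have A: "?A \<in> sets (borel \<Otimes>\<^sub>M borel)"
    by (simp add: space_pair_measure)
  have sect: "(\<lambda>x. (x, y)) -` ?A = {c - y}" for y
    by (auto simp: algebra_simps)
  have "emeasure M {\<omega>\<in>space M. X \<omega> + Y \<omega> = c}
      = emeasure (distr M (borel \<Otimes>\<^sub>M borel) (\<lambda>x. (X x, Y x))) ?A"
    using A by (subst emeasure_distr) (auto intro!: arg_cong[where f = "emeasure M"])
  also have "\<dots> = (\<integral>\<^sup>+ y. emeasure (distr M borel X) ((\<lambda>x. (x, y)) -` ?A) \<partial>distr M borel Y)"
    unfolding eq[symmetric] using A by (subst XY.emeasure_pair_measure_alt2) auto
  also have "\<dots> = 0"
    by (simp only: sect atomless nn_integral_0_iff_AE) simp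
  finally have "{\<omega>\<in>space M. X \<omega> + Y \<omega> = c} \<in> null_sets M"
    by (auto intro!: null_setsI)
  then show ?thesis
    by (rule AE_I') auto
qed

text \<open>Common terms cancel, so the difference of the two sums is a signed sum over the nonempty
  symmetric difference. Any one of its terms is atomless and independent of the rest.\<close>

lemma (in prob_space) AE_sum_neq_if_atomless:
  fixes w :: "'i \<Rightarrow> 'a \<Rightarrow> real"
  assumes indep: "indep_vars (\<lambda>_. borel) w E"
    and atomless: "\<And>f x. f \<in> E \<Longrightarrow> emeasure (distr M borel (w f)) {x} = 0"
    and A: "finite A" "A \<subseteq> E" and B: "finite B" "B \<subseteq> E" and "A \<noteq> B"
  shows "AE \<omega> in M. (\<Sum>f\<in>A. w f \<omega>) \<noteq> (\<Sum>f\<in>B. w f \<omega>)"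
proof -
  define c :: "'i \<Rightarrow> real" where "c f = (if f \<in> A then 1 else -1)" for f
  define X where "X = (\<lambda>f \<omega>. c f * w f \<omega>)"
  let ?D = "sym_diff A B"
  obtain i where i: "i \<in> ?D" using \<open>A \<noteq> B\<close> by blast
  have D: "finite (?D - {i})" "insert i (?D - {i}) = ?D" "?D \<subseteq> E" using A B i by auto
  have rv [measurable]: "random_variable borel (w f)" if "f \<in> E" for f
    using indep that by (auto simp: indep_vars_def)
  have iE: "i \<in> E" using i D by auto
  have "indep_vars (\<lambda>_. borel) X ?D"
    unfolding X_def by (rule indep_vars_compose2[OF indep_vars_subset[OF indep D(3)], where Y = "\<lambda>f x. c f * x"]) simp
  then have ind: "indep_var borel (X i) borel (\<lambda>\<omega>. \<Sum>f\<in>?D - {i}. X f \<omega>)"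
    using D by (intro indep_vars_sum) simp_all
  \<comment> \<open>The sign \<open>c i\<close> is its own inverse, so \<open>X i\<close> hits
    \<open>x\<close> exactly when \<open>w i\<close> hits \<open>c i * x\<close>.\<close>
  have "emeasure (distr M borel (X i)) {x} = emeasure (distr M borel (w i)) {c i * x}" for x
  proof -
    have "X i -` {x} \<inter> space M = w i -` {c i * x} \<inter> space M"
      by (auto simp: X_def c_def)
    moreover have "random_variable borel (X i)" using rv[OF iE] by (simp add: X_def)
    ultimately show ?thesis using rv[OF iE] by (simp add: emeasure_distr)
  qed
  with atomless[OF iE] have "AE \<omega> in M. X i \<omega> + (\<Sum>f\<in>?D - {i}. X f \<omega>) \<noteq> 0"
    by (intro AE_add_neq_if_atomless[OF ind]) simp
  moreover have "X i \<omega> + (\<Sum>f\<in>?D - {i}. X f \<omega>) = (\<Sum>f\<in>A. w f \<omega>) - (\<Sum>f\<in>B. w f \<omega>)" for \<omega>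
  proof -
    have "X i \<omega> + (\<Sum>f\<in>?D - {i}. X f \<omega>) = (\<Sum>f\<in>?D. X f \<omega>)"
      using D(1,2) i by (metis Diff_insert_absorb finite_insert sum.remove)
    also have "\<dots> = (\<Sum>f\<in>A - B. X f \<omega>) + (\<Sum>f\<in>B - A. X f \<omega>)"
      using A B by (intro sum.union_disjoint) auto
    also have "(\<Sum>f\<in>A - B. X f \<omega>) = (\<Sum>f\<in>A - B. w f \<omega>)"
      by (intro sum.cong) (auto simp: X_def c_def)
    also have "(\<Sum>f\<in>B - A. X f \<omega>) = - (\<Sum>f\<in>B - A. w f \<omega>)"
      unfolding sum_negf[symmetric] by (intro sum.cong) (auto simp: X_def c_def)
    also have "(\<Sum>f\<in>A - B. w f \<omega>) = (\<Sum>f\<in>A. w f \<omega>) - (\<Sum>f\<in>A \<inter> B. w f \<omega>)"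
      using A by (subst sum.Int_Diff[of A _ B]) auto
    also have "(\<Sum>f\<in>B - A. w f \<omega>) = (\<Sum>f\<in>B. w f \<omega>) - (\<Sum>f\<in>A \<inter> B. w f \<omega>)"
      using B by (subst sum.Int_Diff[of B _ A]) (auto simp: Int_commute)
    finally show ?thesis by simp
  qed
  ultimately show ?thesis by simp
qed

lemma (in prob_space) AE_distinct_weights:
  assumes "countable (edges G)" "indep_vars (\<lambda>_. borel) w (edges G)"
    and "\<And>f x. f \<in> edges G \<Longrightarrow> emeasure (distr M borel (w f)) {x} = 0"
  shows "AE \<omega> in M. distinct_weights G (\<lambda>f. w f \<omega>)"
proof -
  let ?S = "{A. finite A \<and> A \<subseteq> edges G}"
  have "countable ?S" using countable_Collect_finite_subset[OF assms(1)] .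
  then have "AE \<omega> in M. \<forall>A\<in>?S. \<forall>B\<in>?S. A \<noteq> B \<longrightarrow> (\<Sum>f\<in>A. w f \<omega>) \<noteq> (\<Sum>f\<in>B. w f \<omega>)"
    unfolding AE_ball_countable[OF \<open>countable ?S\<close>]
    using AE_sum_neq_if_atomless[OF assms(2,3)] by auto
  then show ?thesis
    by eventually_elim (auto simp: distinct_weights_def inj_on_def)
qed

section \<open>Finiteness of balls\<close>

lemma finite_walks_of_length:
  assumes "ugraph G" "locally_finite G"
  shows "u \<in> verts G \<Longrightarrow> finite {p. length p = Suc k \<and> hd p = u \<and> successively (adjacent G) p}"
proof (induction k arbitrary: u)
  case 0
  have "{p. length p = Suc 0 \<and> hd p = u \<and> successively (adjacent G) p} \<subseteq> {[u]}"
    by (auto simp: length_Suc_conv)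
  then show ?case by (rule finite_subset) simp
next
  case (Suc k)
  let ?N = "{x. adjacent G u x}"
  let ?W = "\<lambda>x. {p. length p = Suc k \<and> hd p = x \<and> successively (adjacent G) p}"
  have "finite ?N" using assms Suc.prems by (simp add: locally_finite_def)
  moreover have "x \<in> verts G" if "x \<in> ?N" for x
    using that assms(1) by (auto simp: adjacent_def ugraph_def)
  ultimately have fin: "finite (\<Union>x\<in>?N. (#) u ` ?W x)"
    using Suc.IH by auto
  have "{p. length p = Suc (Suc k) \<and> hd p = u \<and> successively (adjacent G) p} \<subseteq> (\<Union>x\<in>?N. (#) u ` ?W x)"
    by (auto simp: length_Suc_conv)
  then show ?case using fin by (rule finite_subset)
qed

text \<open>The infimum of an empty set in \<open>enat\<close> is \<infinity>, so a finite bound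
  forces some walk to exist. A nonempty infimum in \<open>enat\<close> is attained, because it is a
  least element.\<close>

lemma graph_dist_le_imp_walk:
  assumes "graph_dist G u v \<le> enat r"
  obtains p where "p \<in> walks G u v" "length p \<le> Suc r"
proof -
  let ?I = "(\<lambda>p. enat (length p - 1)) ` walks G u v"
  have ne: "?I \<noteq> {}" using assms by (auto simp: graph_dist_def Inf_enat_def)
  then have "graph_dist G u v \<in> ?I"
    unfolding graph_dist_def Inf_enat_def by (auto intro: LeastI)
  then obtain p where "p \<in> walks G u v" "graph_dist G u v = enat (length p - 1)" by blast
  with assms that show thesis by auto
qed

lemma finite_graph_dist_ball:
  assumes "ugraph G" "locally_finite G" "u \<in> verts G"
  shows "finite {v. graph_dist G u v \<le> enat r}"
proof (rule finite_subset)
  let ?W = "\<lambda>k. {p. length p = Suc k \<and> hd p = u \<and> successively (adjacent G) p}"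
  show "finite (\<Union>k\<le>r. last ` ?W k)"
    using finite_walks_of_length[OF assms] by blast
  show "{v. graph_dist G u v \<le> enat r} \<subseteq> (\<Union>k\<le>r. last ` ?W k)"
  proof clarify
    fix v assume "graph_dist G u v \<le> enat r"
    then obtain p where p: "p \<in> walks G u v" "length p \<le> Suc r"
      by (rule graph_dist_le_imp_walk)
    then have "p \<in> ?W (length p - 1)" "last p = v" "length p - 1 \<le> r"
      by (auto simp: walks_def Suc_le_eq)
    then show "v \<in> (\<Union>k\<le>r. last ` ?W k)" by blast
  qed
qed

lemma edges_edge_ball_subset: "edges (edge_ball G f r) \<subseteq> edges G"
  by (auto simp: edge_ball_def induced_def)

lemma finite_verts_edge_ball:
  assumes "ugraph G" "locally_finite G" "f \<in> edges G"
  shows "finite (verts (edge_ball G f r))"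
proof -
  have f: "f \<subseteq> verts G" "finite f"
    using assms(1,3) by (auto simp: ugraph_def intro: card_ge_0_finite)
  then have "finite (\<Union>u\<in>f. {v. graph_dist G u v \<le> enat r})"
    using finite_graph_dist_ball[OF assms(1,2)] by blast
  then show ?thesis
    by (rule rev_finite_subset) (auto simp: edge_ball_def induced_def)
qed

lemma finite_edges_edge_ball:
  assumes "ugraph G" "locally_finite G" "f \<in> edges G"
  shows "finite (edges (edge_ball G f r))"
proof (rule finite_subset)
  show "edges (edge_ball G f r) \<subseteq> Pow (verts (edge_ball G f r))"
    using assms(1) by (auto simp: edge_ball_def induced_def ugraph_def)
qed (simp add: finite_verts_edge_ball[OF assms])

lemma graph_dist_self: "u \<in> verts G \<Longrightarrow> graph_dist G u u \<le> enat r"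
proof -
  assume "u \<in> verts G"
  then have "[u] \<in> walks G u u" by (simp add: walks_def)
  then have "graph_dist G u u \<le> enat (length [u] - 1)"
    unfolding graph_dist_def by (rule INF_lower)
  also have "\<dots> \<le> enat r" by simp
  finally show ?thesis .
qed

lemma mem_edges_edge_ball:
  assumes "ugraph G" "f \<in> edges G"
  shows "f \<in> edges (edge_ball G f r)"
proof -
  have "f \<subseteq> verts G" using assms by (auto simp: ugraph_def)
  then show ?thesis using assms(2) graph_dist_self[of _ G r]
    by (auto simp: edge_ball_def induced_def)
qed

section \<open>Restricting a maximum matching to a ball\<close>

text \<open>The edges \<open>R\<close> of the maximum matching of \<open>K\<close> outside
  \<open>B\<close> block precisely the vertices in \<open>A\<close>. Every matching of
  \<open>B\<close> avoiding \<open>A\<close> can be completed by \<open>R\<close> to a matching of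
  \<open>K\<close>, so the part inside \<open>B\<close> must itself be optimal after
  \<open>A\<close> is deleted.\<close>

lemma max_matching_Int_induced:
  assumes G: "ugraph G" "distinct_weights G W"
    and K: "finite (edges K)" "edges K \<subseteq> edges G" "edges (induced G S) \<subseteq> edges K"
  obtains A where "A \<subseteq> vertex_boundary G (induced G S)"
    and "max_matching K W \<inter> edges (induced G S) = max_matching (delete_verts (induced G S) A) W"
proof -
  define B where "B = induced G S"
  define MK where "MK = max_matching K W"
  define R where "R = MK - edges B"
  define A where "A = {v \<in> verts B. \<exists>g\<in>R. v \<in> g}"
  define H where "H = delete_verts B A"
  have MK: "MK \<subseteq> edges K" "pairwise disjnt MK"
    using max_matching_matching[OF K(1), of W] by (auto simp: matching_def MK_def)
  have EB: "g \<in> edges B \<longleftrightarrow> g \<in> edges G \<and> g \<subseteq> verts B" for g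
    using G(1) by (auto simp: B_def induced_def ugraph_def)
  have EH: "g \<in> edges H \<longleftrightarrow> g \<in> edges B \<and> g \<inter> A = {}" for g
    by (auto simp: H_def delete_verts_def induced_def EB)
  have HK: "edges H \<subseteq> edges K" using K(3) EH by (auto simp: B_def)
  have finH: "finite (edges H)" using HK K(1) finite_subset by blast
  have "A \<subseteq> vertex_boundary G B"
  proof
    fix v assume "v \<in> A"
    then obtain g where v: "v \<in> verts B" and g: "g \<in> R" "v \<in> g" by (auto simp: A_def)
    have gG: "g \<in> edges G" "g \<notin> edges B" using g MK K by (auto simp: R_def)
    with G(1) have c: "card g = 2" "g \<subseteq> verts G" by (auto simp: ugraph_def)
    \<comment> \<open>Since \<open>B\<close> is induced, an edge of \<open>G\<close> that is missing
      from \<open>B\<close> must have an endpoint outside \<open>B\<close>.\<close>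
    from gG EB obtain u where u: "u \<in> g" "u \<notin> verts B" by auto
    have "g = {v, u}"
      using c u g v card_2_iff by (metis (no_types, lifting) doubleton_eq_iff insertE singletonD)
    then show "v \<in> vertex_boundary G B"
      using v u c gG by (auto simp: vertex_boundary_def adjacent_def)
  qed
  moreover have "MK \<inter> edges B = max_matching H W"
  proof (rule max_matching_eqI[OF G(2) finH])
    show "edges H \<subseteq> edges G" using HK K(2) by blast
    show "matching H (MK \<inter> edges B)"
      unfolding matching_def
    proof
      show "MK \<inter> edges B \<subseteq> edges H"
      proof
        fix g assume g: "g \<in> MK \<inter> edges B"
        \<comment> \<open>Vertices of \<open>A\<close> are already covered by edges of
          \<open>R\<close>, which belong to the same matching \<open>MK\<close> as
          \<open>g\<close>.\<close>
        have "g \<inter> A = {}"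
        proof (rule ccontr)
          assume "g \<inter> A \<noteq> {}"
          then obtain v h where "v \<in> g" "h \<in> R" "v \<in> h" by (auto simp: A_def)
          moreover from this have "g \<noteq> h" using g by (auto simp: R_def)
          ultimately show False
            using g pairwiseD[OF MK(2), of g h] by (auto simp: R_def disjnt_def)
        qed
        with g EH show "g \<in> edges H" by blast
      qed
      show "pairwise disjnt (MK \<inter> edges B)" using MK(2) by (rule pairwise_subset) blast
    qed
    let ?M = "max_matching H W"
    have M: "matching H ?M" using max_matching_matching[OF finH] .
    then have MH: "?M \<subseteq> edges H" "pairwise disjnt ?M" by (auto simp: matching_def)
    have cross: "disjnt g h" if "g \<in> ?M" "h \<in> R" for g h
    proof -
      have "g \<in> edges H" using that MH by blast
      then have "g \<subseteq> verts B" "g \<inter> A = {}" using EH EB by auto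
      then show ?thesis using that(2) by (auto simp: A_def disjnt_def)
    qed
    \<comment> \<open>Replacing the inner part of \<open>MK\<close> by the optimum of
      \<open>H\<close> cannot beat \<open>MK\<close>. Cancelling the weight of \<open>R\<close> then
      gives the required inequality.\<close>
    have "matching K (?M \<union> R)"
      unfolding matching_def
    proof
      show "?M \<union> R \<subseteq> edges K" using MH HK MK by (auto simp: R_def)
      show "pairwise disjnt (?M \<union> R)"
        using MH(2) MK(2) cross by (auto simp: pairwise_def R_def disjnt_sym)
    qed
    then have "sum W (?M \<union> R) \<le> sum W MK"
      unfolding MK_def by (rule max_matching_ge[OF K(1)])
    moreover have finMK: "finite MK" using MK(1) K(1) finite_subset by blast
    moreover have "sum W (?M \<union> R) = sum W ?M + sum W R"
      using finMK MH EH matching_finite[OF finH M] by (intro sum.union_disjoint) (auto simp: R_def)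
    moreover have "sum W MK = sum W (MK \<inter> edges B) + sum W R"
      unfolding R_def using finMK by (rule sum.Int_Diff)
    ultimately show "sum W ?M \<le> sum W (MK \<inter> edges B)" by simp
  qed
  ultimately show thesis using that unfolding MK_def H_def B_def by blast
qed

text \<open>Restriction to the ball keeps the status of \<open>f\<close>, as \<open>f\<close> is an
  edge of its own ball. By \<open>decays_at\<close> the set \<open>A\<close>, which depends on
  \<open>K\<close>, does not change this status either.\<close>

lemma mem_max_matching_eq_ball:
  assumes "ugraph G" "distinct_weights G W" "f \<in> edges G" "decays_at G W f r"
    and "finite (edges K)" "edges K \<subseteq> edges G" "edges (edge_ball G f r) \<subseteq> edges K"
  shows "f \<in> max_matching K W \<longleftrightarrow> f \<in> max_matching (edge_ball G f r) W"
proof -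
  obtain A where "A \<subseteq> vertex_boundary G (edge_ball G f r)"
    "max_matching K W \<inter> edges (edge_ball G f r) = max_matching (delete_verts (edge_ball G f r) A) W"
    using max_matching_Int_induced[OF assms(1,2,5,6), of "{v \<in> verts G. \<exists>u\<in>f. graph_dist G u v \<le> enat r}"]
      assms(7) unfolding edge_ball_def by blast
  then show ?thesis
    using assms(4) mem_edges_edge_ball[OF assms(1,3), of r] unfolding decays_at_def by blast
qed

section \<open>Limits along exhausting sequences\<close>

lemma increases_toD:
  assumes "increases_to Gs G"
  shows "finite (edges (Gs n))" "edges (Gs n) \<subseteq> edges G"
  using assms finite_edges_if_finite_verts[of "Gs n"] by (auto simp: increases_to_def subgraph_def)

lemma increases_to_eventually:
  assumes "increases_to Gs G" "finite T" "T \<subseteq> edges G"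
  shows "\<forall>\<^sub>F n in sequentially. T \<subseteq> edges (Gs n)"
proof -
  have "incseq (\<lambda>n. edges (Gs n))"
    using assms(1) by (intro incseq_SucI) (auto simp: increases_to_def subgraph_def)
  then have mono: "edges (Gs m) \<subseteq> edges (Gs n)" if "m \<le> n" for m n
    using that by (auto simp: incseq_def)
  have "\<forall>\<^sub>F n in sequentially. t \<in> edges (Gs n)" if "t \<in> T" for t
  proof -
    have "t \<in> (\<Union>n. edges (Gs n))" using that assms by (auto simp: increases_to_def)
    then obtain m where "t \<in> edges (Gs m)" by blast
    then show ?thesis using mono unfolding eventually_sequentially by blast
  qed
  then have "\<forall>\<^sub>F n in sequentially. \<forall>t\<in>T. t \<in> edges (Gs n)"
    using assms(2) by (simp add: eventually_ball_finite_distrib)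
  then show ?thesis by eventually_elim blast
qed

lemma increases_to_countable_edges: "increases_to Gs G \<Longrightarrow> countable (edges G)"
proof -
  assume *: "increases_to Gs G"
  have "countable (\<Union>n. edges (Gs n))"
    using increases_toD(1)[OF *] by (intro countable_UN) (auto intro: countable_finite)
  then show ?thesis using * by (simp add: increases_to_def)
qed

text \<open>This keeps the neighbourhood of a finite exchange finite, so that eventual agreement
  holds on all of it simultaneously.\<close>

lemma incident_edges_finite:
  assumes "ugraph G" "locally_finite G" "finite V"
  shows "finite {g \<in> edges G. g \<inter> V \<noteq> {}}"
proof (rule finite_subset)
  show "finite (\<Union>v\<in>V \<inter> verts G. (\<lambda>u. {v, u}) ` {u. adjacent G v u})"
    using assms(2,3) by (auto simp: locally_finite_def)
  show "{g \<in> edges G. g \<inter> V \<noteq> {}} \<subseteq> (\<Union>v\<in>V \<inter> verts G. (\<lambda>u. {v, u}) ` {u. adjacent G v u})"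
  proof clarify
    fix g assume g: "g \<in> edges G" "g \<inter> V \<noteq> {}"
    then obtain v where v: "v \<in> g" "v \<in> V" by blast
    have c: "card g = 2" "g \<subseteq> verts G" using assms(1) g by (auto simp: ugraph_def)
    then obtain u where "g = {v, u}"
      using v(1) by (auto simp: card_2_iff)
    then show "g \<in> (\<Union>v\<in>V \<inter> verts G. (\<lambda>u. {v, u}) ` {u. adjacent G v u})"
      using v c g by (auto simp: adjacent_def)
  qed
qed

text \<open>Indicators take only the values 0 and 1, so values at distance less than 1
  coincide.\<close>

lemma tendsto_indicat_real_iff:
  "(\<lambda>n. indicat_real (A n) x) \<longlonglongrightarrow> indicat_real B x \<longleftrightarrow> (\<forall>\<^sub>F n in sequentially. x \<in> A n \<longleftrightarrow> x \<in> B)"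
proof
  assume "(\<lambda>n. indicat_real (A n) x) \<longlonglongrightarrow> indicat_real B x"
  then have "\<forall>\<^sub>F n in sequentially. dist (indicat_real (A n) x) (indicat_real B x) < 1"
    by (rule tendstoD) simp
  then show "\<forall>\<^sub>F n in sequentially. x \<in> A n \<longleftrightarrow> x \<in> B"
  proof eventually_elim
    case (elim n)
    then show ?case by (cases "x \<in> A n"; cases "x \<in> B") simp_all
  qed
next
  assume "\<forall>\<^sub>F n in sequentially. x \<in> A n \<longleftrightarrow> x \<in> B"
  then show "(\<lambda>n. indicat_real (A n) x) \<longlonglongrightarrow> indicat_real B x"
    by (intro tendsto_eventually) (auto elim!: eventually_mono simp: indicator_def)
qed

lemma limit_matching_eq:
  assumes "L \<subseteq> edges G"
    and "\<And>f. f \<in> edges G \<Longrightarrow> \<forall>\<^sub>F n in sequentially. f \<in> max_matching (Gs n) W \<longleftrightarrow> f \<in> L"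
  shows "limit_matching G Gs W = L"
proof -
  have lim: "(\<lambda>n. indicat_real (max_matching (Gs n) W) f) \<longlonglongrightarrow> indicat_real L f" if "f \<in> edges G" for f
    using assms(2)[OF that] by (simp add: tendsto_indicat_real_iff)
  have "(\<lambda>n. indicat_real (max_matching (Gs n) W) f) \<longlonglongrightarrow> 1 \<longleftrightarrow> indicat_real L f = 1"
    if "f \<in> edges G" for f
    using lim[OF that] LIMSEQ_unique[OF lim[OF that], of 1] by auto
  with assms(1) show ?thesis by (auto simp: limit_matching_def indicator_eq_1_iff)
qed

text \<open>Any two edges of \<open>L\<close> lie together in the maximum matching of one
  \<open>Gs n\<close>, hence are disjoint if distinct.\<close>

lemma matching_if_eventually:
  assumes "increases_to Gs G" "L \<subseteq> edges G"
    and ev: "\<And>f. f \<in> edges G \<Longrightarrow> \<forall>\<^sub>F n in sequentially. f \<in> max_matching (Gs n) W \<longleftrightarrow> f \<in> L"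
  shows "matching G L"
  unfolding matching_def
proof
  show "L \<subseteq> edges G" by fact
  show "pairwise disjnt L"
  proof (rule pairwiseI)
    fix f g assume fg: "f \<in> L" "g \<in> L" "f \<noteq> g"
    then have "\<forall>\<^sub>F n in sequentially. f \<in> max_matching (Gs n) W \<and> g \<in> max_matching (Gs n) W"
      using ev[of f] ev[of g] assms(2) by (auto intro: eventually_elim2)
    then obtain n where "f \<in> max_matching (Gs n) W" "g \<in> max_matching (Gs n) W"
      by (auto simp: eventually_sequentially)
    then show "disjnt f g"
      using max_matching_matching[OF increases_toD(1)[OF assms(1)], of n W] fg(3)
      by (auto simp: matching_def pairwise_def)
  qed
qed

text \<open>
  The finite exchange \<open>L \<leadsto> M\<close> can be carried out inside \<open>Gs n\<close> as soon as the maximum matching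
  of \<open>Gs n\<close> agrees with \<open>L\<close> on all edges touching the exchanged ones.
\<close>

lemma local_optimality:
  assumes G: "ugraph G" "locally_finite G" "distinct_weights G W"
    and inc: "increases_to Gs G" and L: "L \<subseteq> edges G"
    and ev: "\<And>f. f \<in> edges G \<Longrightarrow> \<forall>\<^sub>F n in sequentially. f \<in> max_matching (Gs n) W \<longleftrightarrow> f \<in> L"
    and M: "matching G M" "finite (sym_diff M L)" "M \<noteq> L"
  shows "(\<Sum>f\<in>M - L. W f) < (\<Sum>f\<in>L - M. W f)"
proof -
  \<comment> \<open>Besides the exchanged edges, \<open>T\<close> holds every edge that could
    conflict with them. Agreement on \<open>T\<close> thus rules out collisions with edges left
    unexchanged.\<close>
  define T where "T = {g \<in> edges G. g \<inter> \<Union>(sym_diff M L) \<noteq> {}}"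
  have MG: "M \<subseteq> edges G" "pairwise disjnt M" using M(1) by (auto simp: matching_def)
  have card: "card g = 2" if "g \<in> edges G" for g using that G(1) by (auto simp: ugraph_def)
  have sub: "sym_diff M L \<subseteq> edges G" using MG L by auto
  have "finite (\<Union>(sym_diff M L))"
  proof (rule finite_Union[OF M(2)])
    show "finite g" if "g \<in> sym_diff M L" for g
      using card[of g] sub that by (metis card.infinite subsetD zero_neq_numeral)
  qed
  then have T: "finite T" "T \<subseteq> edges G"
    unfolding T_def using incident_edges_finite[OF G(1,2)] by auto
  have DT: "sym_diff M L \<subseteq> T"
  proof
    fix g assume g: "g \<in> sym_diff M L"
    then have "g \<noteq> {}" using card[of g] sub by auto
    with g sub show "g \<in> T" unfolding T_def by blast
  qed
  have "\<forall>\<^sub>F n in sequentially. \<forall>f\<in>T. f \<in> max_matching (Gs n) W \<longleftrightarrow> f \<in> L"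
    using T ev by (subst eventually_ball_finite_distrib) auto
  then have "\<forall>\<^sub>F n in sequentially. (\<forall>f\<in>T. f \<in> max_matching (Gs n) W \<longleftrightarrow> f \<in> L) \<and> T \<subseteq> edges (Gs n)"
    using increases_to_eventually[OF inc T] by (rule eventually_conj)
  then obtain n where agree: "\<And>f. f \<in> T \<Longrightarrow> f \<in> max_matching (Gs n) W \<longleftrightarrow> f \<in> L"
    and TK: "T \<subseteq> edges (Gs n)"
    by (auto simp: eventually_sequentially)
  define N where "N = max_matching (Gs n) W"
  define N' where "N' = (N - (L - M)) \<union> (M - L)"
  note K = increases_toD[OF inc, of n]
  have N: "N \<subseteq> edges (Gs n)" "pairwise disjnt N"
    using max_matching_matching[OF K(1), of W] by (auto simp: N_def matching_def)
  have LN: "L - M \<subseteq> N" "N \<inter> (M - L) = {}"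
    using DT agree by (auto simp: N_def)
  have cross: "disjnt g h" if "g \<in> N - (L - M)" "h \<in> M - L" for g h
  proof (rule ccontr)
    assume nd: "\<not> disjnt g h"
    then have "g \<in> T"
      using that N K(2) by (auto simp: T_def disjnt_def)
    \<comment> \<open>As \<open>g\<close> lies in \<open>L\<close> but not in \<open>L - M\<close>,
      it lies in \<open>M\<close>. There it cannot touch the distinct edge \<open>h\<close>.\<close>
    then have "g \<in> L" using that agree by (auto simp: N_def)
    then have "g \<in> M" "g \<noteq> h" using that by auto
    then show False using nd that MG(2) by (auto simp: pairwise_def)
  qed
  have "matching (Gs n) N'"
    unfolding matching_def
  proof
    show "N' \<subseteq> edges (Gs n)" using N DT TK by (auto simp: N'_def)
    show "pairwise disjnt N'"
      using N(2) MG(2) cross by (auto simp: pairwise_def N'_def disjnt_sym)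
  qed
  \<comment> \<open>Either \<open>M - L\<close> contributes an edge absent from \<open>N\<close>, or
    \<open>L - M\<close> removes one. Uniqueness of the maximiser then makes the inequality
    strict.\<close>
  moreover have "N' \<noteq> N" using M(3) LN by (auto simp: N'_def)
  ultimately have "sum W N' < sum W N"
    using max_matching_eqI[OF G(3) K, of N'] unfolding N_def by fastforce
  moreover have finN: "finite N" using N(1) K(1) finite_subset by blast
  moreover have "sum W N' = sum W (N - (L - M)) + sum W (M - L)"
    unfolding N'_def using finN LN M(2) by (intro sum.union_disjoint) auto
  moreover have "sum W (N - (L - M)) = sum W N - sum W (L - M)"
    using finN LN by (intro sum_diff) auto
  ultimately show ?thesis by simp
qed

section \<open>From correlation decay to a random finite radius\<close>

lemma (in prob_space) AE_decays_at:
  assumes G: "ugraph G" "locally_finite G" "f \<in> edges G"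
    and rv: "\<And>g. g \<in> edges G \<Longrightarrow> w g \<in> borel_measurable M"
    and decay: "(\<lambda>r. corr_rho M w r G f) \<longlonglongrightarrow> 0"
  shows "AE \<omega> in M. \<exists>r. decays_at G (\<lambda>g. w g \<omega>) f r"
proof -
  let ?B = "edge_ball G f"
  let ?P = "\<lambda>r. Pow (vertex_boundary G (?B r))"
  define Y where "Y r A \<omega> = \<bar>indicat_real (max_matching (?B r) (\<lambda>g. w g \<omega>)) f
      - indicat_real (max_matching (delete_verts (?B r) A) (\<lambda>g. w g \<omega>)) f\<bar>" for r A \<omega>
  define X where "X r \<omega> = (SUP A\<in>?P r. Y r A \<omega>)" for r \<omega>
  have finP: "finite (?P r)" for r
    using finite_verts_edge_ball[OF G] by (simp add: vertex_boundary_def)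
  have finB: "finite (edges (?B r))" for r using finite_edges_edge_ball[OF G] .
  have sub: "edges (delete_verts (?B r) A) \<subseteq> edges (?B r)" for r A
    by (auto simp: delete_verts_def induced_def)
  have meas: "(\<lambda>\<omega>. indicat_real (max_matching H (\<lambda>g. w g \<omega>)) f) \<in> borel_measurable M"
    if "edges H \<subseteq> edges (?B r)" for H r
  proof -
    have "(\<lambda>\<omega>. max_matching H (\<lambda>g. w g \<omega>)) \<in> measurable M (count_space UNIV)"
      using that finB rv edges_edge_ball_subset
      by (intro measurable_max_matching) (blast intro: finite_subset)+
    then show ?thesis by (rule measurable_compose) simp
  qed
  have Ym: "Y r A \<in> borel_measurable M" for r A
    unfolding Y_def using meas[OF order_refl, of r] meas[OF sub, of r A] by measurable
  have Y1: "0 \<le> Y r A \<omega>" "Y r A \<omega> \<le> 1" for r A \<omega>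
    by (auto simp: Y_def indicator_def)
  have bdd: "bdd_above ((\<lambda>A. Y r A \<omega>) ` ?P r)" for r \<omega>
    using Y1 by (intro bdd_aboveI2)
  \<comment> \<open>The boundary of a ball is finite, so this is a supremum of finitely many
    measurable functions.\<close>
  have Xm [measurable]: "X r \<in> borel_measurable M" for r
    unfolding X_def using finP Ym bdd by (intro borel_measurable_cSUP countable_finite)
  have X1: "X r \<omega> \<le> 1" for r \<omega>
    unfolding X_def using Y1 by (intro cSUP_least) auto
  have X0: "0 \<le> X r \<omega>" for r \<omega>
    unfolding X_def by (rule cSUP_upper2[OF bdd _ Y1(1)[of r "{}"]]) simp
  \<comment> \<open>Integrability ensures that a small \<open>corr_rho\<close> reflects a small
    supremum, and not the default value 0 of the integral.\<close>
  have int: "integrable M (X r)" for r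
    using X0 X1 Xm by (intro integrable_const_bound[of _ 1]) auto
  have rho: "corr_rho M w r G f = (\<integral>\<omega>. X r \<omega> \<partial>M)" for r
    by (simp add: corr_rho_def X_def Y_def Let_def)
  define Bad where "Bad = {\<omega>\<in>space M. \<forall>r. 1 \<le> X r \<omega>}"
  have Bad: "Bad \<in> events" unfolding Bad_def by measurable
  have "prob Bad \<le> corr_rho M w r G f" for r
  proof -
    have "prob Bad \<le> prob {\<omega>\<in>space M. 1 \<le> X r \<omega>}"
      by (rule finite_measure_mono) (auto simp: Bad_def)
    also have "\<dots> \<le> (\<integral>\<omega>. X r \<omega> \<partial>M) / 1"
      using X0 by (intro integral_Markov_inequality_measure[OF int sets.empty_sets]) auto
    finally show ?thesis by (simp add: rho)
  qed
  then have "prob Bad \<le> 0"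
    by (intro LIMSEQ_le_const[OF decay]) blast
  then have "prob Bad = 0" by (simp add: measure_le_0_iff)
  then have "Bad \<in> null_sets M" using Bad by (auto simp: emeasure_eq_measure)
  then have "AE \<omega> in M. \<omega> \<notin> Bad" by (rule AE_not_in)
  then show ?thesis
  proof (rule AE_mp, intro AE_I2 impI)
    fix \<omega> assume "\<omega> \<in> space M" "\<omega> \<notin> Bad"
    then obtain r where r: "X r \<omega> < 1" by (auto simp: Bad_def not_le)
    have "decays_at G (\<lambda>g. w g \<omega>) f r"
      unfolding decays_at_def
    proof (intro allI impI)
      fix A assume "A \<subseteq> vertex_boundary G (?B r)"
      then have "Y r A \<omega> \<le> X r \<omega>" unfolding X_def by (intro cSUP_upper bdd) auto
      \<comment> \<open>An absolute difference of two indicators that is below 1 is 0.\<close>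
      then have "Y r A \<omega> < 1" using r by simp
      then show "f \<in> max_matching (delete_verts (?B r) A) (\<lambda>g. w g \<omega>)
          \<longleftrightarrow> f \<in> max_matching (?B r) (\<lambda>g. w g \<omega>)"
        by (auto simp: Y_def indicator_def split: if_splits)
    qed
    then show "\<exists>r. decays_at G (\<lambda>g. w g \<omega>) f r" ..
  qed
qed

theorem proposition1p6:
  fixes G :: "'v ugraph"
    and P :: "'a measure"
    and w :: "'v set \<Rightarrow> 'a \<Rightarrow> real"
    and F :: "real measure"
    and e :: "'v set"
    and Gs :: "nat \<Rightarrow> 'v ugraph"
  assumes "ugraph G" and "locally_finite G" and "infinite (verts G)" and "connected_ugraph G"
    and "prob_space P"
    and "prob_space.indep_vars P (\<lambda>_. borel) w (edges G)"
    and "\<And>f. f \<in> edges G \<Longrightarrow> distr P borel (w f) = F"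
    and "\<And>x. emeasure F {x} = 0"
    and "\<And>f. f \<in> edges G \<Longrightarrow> AE \<omega> in P. 0 \<le> w f \<omega>"
    and "\<And>f. f \<in> edges G \<Longrightarrow> (\<lambda>r. corr_rho P w r G f) \<longlonglongrightarrow> 0"
    and "e \<in> edges G"
    and "increases_to Gs G"
  shows "AE \<omega> in P.
    (let W = (\<lambda>f. w f \<omega>); MG = limit_matching G Gs W in
      convergent (\<lambda>n. indicat_real (max_matching (Gs n) W) e) \<and>
      (\<forall>Gs'. increases_to Gs' G \<longrightarrow>
         (\<lambda>n. indicat_real (max_matching (Gs' n) W) e)
           \<longlonglongrightarrow> lim (\<lambda>n. indicat_real (max_matching (Gs n) W) e) \<and>
         limit_matching G Gs' W = MG) \<and>
      matching G MG \<and>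
      (\<forall>M. matching G M \<and> finite (sym_diff M MG) \<and> M \<noteq> MG \<longrightarrow>
         (\<Sum>f\<in>MG - M. W f) > (\<Sum>f\<in>M - MG. W f)))"
proof -
  interpret prob_space P by fact
  note G = assms(1,2) and inc = assms(12)
  have rv: "w f \<in> borel_measurable P" if "f \<in> edges G" for f
    using assms(6) that by (auto simp: indep_vars_def)
  have cnt: "countable (edges G)" using increases_to_countable_edges[OF inc] .
  have "AE \<omega> in P. distinct_weights G (\<lambda>f. w f \<omega>)"
    using assms(7,8) by (intro AE_distinct_weights[OF cnt assms(6)]) simp
  \<comment> \<open>Countability of the edge set merges the null sets of the individual edges into
    one.\<close>
  moreover have "AE \<omega> in P. \<forall>f\<in>edges G. \<exists>r. decays_at G (\<lambda>g. w g \<omega>) f r"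
    using AE_decays_at[OF G _ rv assms(10)] by (simp add: AE_ball_countable cnt)
  ultimately show ?thesis
  proof eventually_elim
    case (elim \<omega>)
    define W where "W = (\<lambda>f. w f \<omega>)"
    have W: "distinct_weights G W" using elim(1) by (simp add: W_def)
    obtain r where r: "\<And>f. f \<in> edges G \<Longrightarrow> decays_at G W f (r f)"
      using elim(2) unfolding W_def by metis
    \<comment> \<open>\<open>L\<close> is read off from the balls alone, with no reference to
      \<open>Gs\<close>. Hence every exhausting sequence \<open>Hs\<close> has this same limit, for
      the same \<omega>.\<close>
    define L where "L = {f \<in> edges G. f \<in> max_matching (edge_ball G f (r f)) W}"
    have L: "L \<subseteq> edges G" by (auto simp: L_def)
    have ev: "\<forall>\<^sub>F n in sequentially. f \<in> max_matching (Hs n) W \<longleftrightarrow> f \<in> L"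
      if "increases_to Hs G" "f \<in> edges G" for Hs f
      using increases_to_eventually[OF that(1) finite_edges_edge_ball[OF G that(2), of "r f"] edges_edge_ball_subset]
    proof eventually_elim
      case (elim n)
      then show ?case
        using mem_max_matching_eq_ball[OF G(1) W that(2) r[OF that(2)] increases_toD[OF that(1)]] that(2)
        by (simp add: L_def)
    qed
    have lim: "(\<lambda>n. indicat_real (max_matching (Hs n) W) e) \<longlonglongrightarrow> indicat_real L e"
      if "increases_to Hs G" for Hs
      using ev[OF that assms(11)] by (simp add: tendsto_indicat_real_iff)
    have LM: "limit_matching G Hs W = L" if "increases_to Hs G" for Hs
      using limit_matching_eq[OF L ev[OF that]] .
    show ?case
      unfolding Let_def W_def[symmetric] LM[OF inc] limI[OF lim[OF inc]]
      using lim LM convergentI[OF lim[OF inc]] matching_if_eventually[OF inc L ev[OF inc]]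
        local_optimality[OF G W inc L ev[OF inc]]
      by blast
  qed
qed

end
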